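(* Let $a_1,\dots,a_n$ be positive integers with $\gcd(a_1,\dots,a_n)=1$, let $m=a_1+\dots+a_n$, $P=(a_1/m,\dots,a_n/m)$, $k=\lceil\log m\rceil$, and let $K\ge k$ be an integer. Then the expected entropy cost of the Amplified Loaded Dice Roller tree satisfies $$H(P)\le \mathbb{E}[C(\mathrm{ALDR}[P,K])] < H(P)+2+(4+K-k)\,2^{k-K}.$$
   Context: All logarithms are base 2; $H_1(x)=x\log(1/x)$ (with $H_1(0)=0$) and $H(P)=\sum_i H_1(p_i)$ is the Shannon entropy. For real $x\ge0$ and integer $d$, $\epsilon_d(x)=\lfloor 2^d x\rfloor \bmod 2$, and $\nu(x)=\sum_d d\,\epsilon_d(x)2^{-d}$ (for $x\in[0,1]$ this is $\sum_{d\ge0} d\,\epsilon_d(x)2^{-d}$). A DDG (discrete distribution generating) tree is a sampler driven by i.i.d. fair bits: a full binary tree (possibly with back edges to the root) whose leaves carry outcome labels; starting at the root, one fair bit is consumed per step to move to the left or right child until a leaf is reached, whose label is output (a back edge returns to the root). $C(T)$ denotes the number of bits consumed. An entropy-optimal DDG tree for a distribution $Q=(q_0,\dots,q_n)$ has exactly $\epsilon_d(q_i)$ leaves labeled $i$ at depth $d$ for every $d\ge1$. FLDR: for positive integers $A_1,\dots,A_n$ with sum $M$, let $K'=\lceil\log M\rceil$, $A_0=2^{K'}-M$ and $Q=(A_0/2^{K'},A_1/2^{K'},\dots,A_n/2^{K'})$; the tree $\mathrm{FLDR}[A_1,\dots,A_n]$ is an entropy-optimal DDG tree for $Q$ in which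 every leaf labeled $0$ is replaced by a back edge to the root (i.e., sample from $Q$ and restart on outcome $0$). Its output distribution is $(A_1/M,\dots,A_n/M)$ and its expected cost is $(2^{K'}/M)\sum_{i=0}^n\nu(A_i/2^{K'})$. ALDR: with $c_K=\lfloor 2^K/m\rfloor$, $\mathrm{ALDR}[P,K]=\mathrm{FLDR}[c_Ka_1,\dots,c_Ka_n]$ (a tree of depth $K$). *)

theory Defs
  imports "HOL-Probability.Probability"
begin

definition H1 :: "real \<Rightarrow> real" where
  "H1 x = (if x = 0 then 0 else x * log 2 (1 / x))"

definition shannon :: "nat \<Rightarrow> (nat \<Rightarrow> real) \<Rightarrow> real" where
  "shannon n p = (\<Sum>i = 1..n. H1 (p i))"

definition bit_eps :: "nat \<Rightarrow> real \<Rightarrow> int" where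
  "bit_eps d x = \<lfloor>2 ^ d * x\<rfloor> mod 2"


text \<open>
  \<open>Back\<close> is a back edge to the root. Finite trees suffice for the samplers considered here: their
  target probabilities are dyadic, so the leaves have bounded depth and their Kraft sum equals 1,
  which leaves no room for an infinite path.
\<close>

datatype ddg = Leaf nat | Back | Node ddg ddg

primrec labels :: "ddg \<Rightarrow> nat set" where
  "labels (Leaf j) = {j}"
| "labels Back = {}"
| "labels (Node l r) = labels l \<union> labels r"

primrec no_back :: "ddg \<Rightarrow> bool" where
  "no_back (Leaf j) \<longleftrightarrow> True"
| "no_back Back \<longleftrightarrow> False"
| "no_back (Node l r) \<longleftrightarrow> no_back l \<and> no_back r"

primrec leaf_count :: "ddg \<Rightarrow> nat \<Rightarrow> nat \<Rightarrow> nat" where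
  "leaf_count (Leaf j) d i = (if d = 0 \<and> i = j then 1 else 0)"
| "leaf_count Back d i = 0"
| "leaf_count (Node l r) d i =
     (case d of 0 \<Rightarrow> 0 | Suc d' \<Rightarrow> leaf_count l d' i + leaf_count r d' i)"


text \<open>
  The sampler with root \<open>T\<close>, currently at \<open>t\<close>, after consuming \<open>n\<close> further bits of \<open>\<omega>\<close>. Following
  a back edge consumes no bit; a sampler that has reached a leaf stays there.
\<close>

definition enter :: "ddg \<Rightarrow> ddg \<Rightarrow> ddg" where
  "enter T t = (if t = Back then T else t)"

primrec ddg_run :: "ddg \<Rightarrow> ddg \<Rightarrow> nat \<Rightarrow> bool stream \<Rightarrow> ddg" where
  "ddg_run T t 0 \<omega> = enter T t"
| "ddg_run T t (Suc n) \<omega> =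
     (case enter T t of
        Node l r \<Rightarrow> ddg_run T (if shd \<omega> then r else l) n (stl \<omega>)
      | u \<Rightarrow> u)"

definition bits_used :: "ddg \<Rightarrow> bool stream \<Rightarrow> enat" where
  "bits_used T \<omega> = (INF n \<in> {n. \<exists>i. ddg_run T T n \<omega> = Leaf i}. enat n)"

definition fair_bits :: "bool stream measure" where
  "fair_bits = stream_space (measure_pmf (bernoulli_pmf (1 / 2)))"

definition expected_cost :: "ddg \<Rightarrow> ennreal" where
  "expected_cost T = (\<integral>\<^sup>+ \<omega>. ennreal_of_enat (bits_used T \<omega>) \<partial>fair_bits)"


text \<open>
  The leaf condition is imposed at depth 0 as well. It matters only if some \<open>q i\<close> equals 1, where it
  forces the one-leaf tree to carry the label \<open>i\<close>.
\<close>

definition entropy_optimal :: "nat \<Rightarrow> (nat \<Rightarrow> real) \<Rightarrow> ddg \<Rightarrow> bool" where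
  "entropy_optimal n q T \<longleftrightarrow>
     no_back T \<and> labels T \<subseteq> {0..n} \<and>
     (\<forall>i\<in>{0..n}. \<forall>d. int (leaf_count T d i) = bit_eps d (q i))"

primrec reject_zero :: "ddg \<Rightarrow> ddg" where
  "reject_zero (Leaf j) = (if j = 0 then Back else Leaf j)"
| "reject_zero Back = Back"
| "reject_zero (Node l r) = Node (reject_zero l) (reject_zero r)"

definition fldr_depth :: "nat \<Rightarrow> (nat \<Rightarrow> nat) \<Rightarrow> nat" where
  "fldr_depth n A = nat \<lceil>log 2 (real (\<Sum>i = 1..n. A i))\<rceil>"

definition fldr_weight :: "nat \<Rightarrow> (nat \<Rightarrow> nat) \<Rightarrow> nat \<Rightarrow> nat" where
  "fldr_weight n A i = (if i = 0 then 2 ^ fldr_depth n A - (\<Sum>j = 1..n. A j) else A i)"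

text \<open>
  The construction determines the tree only up to the arrangement of the nodes within each level;
  \<open>FLDR n A\<close> is the set of all trees it can yield.
\<close>

definition FLDR :: "nat \<Rightarrow> (nat \<Rightarrow> nat) \<Rightarrow> ddg set" where
  "FLDR n A = reject_zero `
     {T. entropy_optimal n (\<lambda>i. real (fldr_weight n A i) / 2 ^ fldr_depth n A) T}"

definition ALDR :: "nat \<Rightarrow> (nat \<Rightarrow> nat) \<Rightarrow> nat \<Rightarrow> ddg set" where
  "ALDR n a K = FLDR n (\<lambda>i. (2 ^ K div (\<Sum>j = 1..n. a j)) * a i)"


subsection \<open>Well-definedness\<close>

lemma measurable_ddg_run: "ddg_run T t n \<in> measurable fair_bits (count_space UNIV)"
proof (induction n arbitrary: t)
  case 0
  show ?case by (simp add: fair_bits_def)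
next
  case (Suc n)
  show ?case
  proof (cases "enter T t")
    case (Node l r)
    have [measurable]: "ddg_run T u n \<in> measurable
        (stream_space (measure_pmf (bernoulli_pmf (1 / 2)))) (count_space UNIV)" for u
      using Suc.IH by (simp add: fair_bits_def)
    have [measurable]: "shd \<in> measurable
        (stream_space (measure_pmf (bernoulli_pmf (1 / 2)))) (count_space UNIV)"
      using measurable_shd[of "measure_pmf (bernoulli_pmf (1 / 2))"]
      by (simp cong: measurable_cong_sets)
    have "ddg_run T t (Suc n) =
        (\<lambda>\<omega>. if shd \<omega> then ddg_run T r n (stl \<omega>) else ddg_run T l n (stl \<omega>))"
      using Node by auto
    then show ?thesis unfolding fair_bits_def by simp
  qed (simp_all add: fair_bits_def)
qed

lemma measurable_bits_used: "bits_used T \<in> measurable fair_bits (count_space UNIV)"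
proof -
  have [measurable]: "ddg_run T T n \<in> measurable fair_bits (count_space UNIV)" for n
    by (rule measurable_ddg_run)
  have "bits_used T = (\<lambda>\<omega>. INF n. if \<exists>i. ddg_run T T n \<omega> = Leaf i then enat n else \<infinity>)"
    (is "_ = ?g")
  proof (intro ext antisym)
    fix \<omega>
    show "bits_used T \<omega> \<le> ?g \<omega>"
      unfolding bits_used_def by (rule INF_greatest) (auto intro: INF_lower)
    show "?g \<omega> \<le> bits_used T \<omega>"
      unfolding bits_used_def
    proof (rule INF_greatest)
      fix j assume "j \<in> {n. \<exists>i. ddg_run T T n \<omega> = Leaf i}"
      then show "?g \<omega> \<le> enat j" by (intro INF_lower2[of j]) auto
    qed
  qed
  also have "?g \<in> measurable fair_bits (count_space UNIV)" by measurable
  finally show ?thesis .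
qed


fun pair_up :: "ddg list \<Rightarrow> ddg list" where
  "pair_up (l # r # ts) = Node l r # pair_up ts"
| "pair_up _ = []"

lemma length_pair_up: "length (pair_up ts) = length ts div 2"
  by (induction ts rule: pair_up.induct) auto

lemma pair_up_ok:
  assumes "even (length ts)" "\<forall>t\<in>set ts. no_back t \<and> labels t \<subseteq> S"
  shows "\<forall>t\<in>set (pair_up ts). no_back t \<and> labels t \<subseteq> S"
  using assms by (induction ts rule: pair_up.induct) auto

lemma pair_up_count:
  assumes "even (length ts)"
  shows "(\<Sum>t\<leftarrow>pair_up ts. leaf_count t d i) =
    (case d of 0 \<Rightarrow> 0 | Suc d' \<Rightarrow> \<Sum>t\<leftarrow>ts. leaf_count t d' i)"
  using assms by (induction ts rule: pair_up.induct) (auto split: nat.splits)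

lemma leaf_list:
  fixes c :: "nat \<Rightarrow> nat"
  shows "\<exists>ts. length ts = (\<Sum>i\<le>n. c i) \<and> (\<forall>t\<in>set ts. no_back t \<and> labels t \<subseteq> {0..n}) \<and>
    (\<forall>i d. (\<Sum>t\<leftarrow>ts. leaf_count t d i) = (if d = 0 \<and> i \<le> n then c i else 0))"
proof (induction n)
  case 0
  show ?case
    by (rule exI[of _ "replicate (c 0) (Leaf 0)"]) (auto simp: sum_list_replicate)
next
  case (Suc n)
  then obtain ts where ts: "length ts = (\<Sum>i\<le>n. c i)"
    "\<forall>t\<in>set ts. no_back t \<and> labels t \<subseteq> {0..n}"
    "\<forall>i d. (\<Sum>t\<leftarrow>ts. leaf_count t d i) = (if d = 0 \<and> i \<le> n then c i else 0)" by blast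
  show ?case
    using ts by (intro exI[of _ "replicate (c (Suc n)) (Leaf (Suc n)) @ ts"])
      (fastforce simp: sum_list_replicate le_Suc_eq)
qed

lemma kraft_forest:
  fixes c :: "nat \<Rightarrow> nat \<Rightarrow> nat"
  assumes "(\<Sum>d\<le>K. \<Sum>i\<le>n. c d i * 2 ^ (K - d)) = N * 2 ^ K"
  shows "\<exists>ts. length ts = N \<and> (\<forall>t\<in>set ts. no_back t \<and> labels t \<subseteq> {0..n}) \<and>
    (\<forall>i d. (\<Sum>t\<leftarrow>ts. leaf_count t d i) = (if d \<le> K \<and> i \<le> n then c d i else 0))"
  using assms
proof (induction K arbitrary: c N)
  case 0
  then have "N = (\<Sum>i\<le>n. c 0 i)" by simp
  moreover obtain ts where "length ts = (\<Sum>i\<le>n. c 0 i)"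
    "\<forall>t\<in>set ts. no_back t \<and> labels t \<subseteq> {0..n}"
    "\<forall>i d. (\<Sum>t\<leftarrow>ts. leaf_count t d i) = (if d = 0 \<and> i \<le> n then c 0 i else 0)"
    using leaf_list[of "c 0" n] by blast
  moreover from this(3) have
    "\<forall>i d. (\<Sum>t\<leftarrow>ts. leaf_count t d i) = (if d \<le> 0 \<and> i \<le> n then c d i else 0)" by simp
  ultimately show ?case by blast
next
  case (Suc K)
  define s where "s = (\<Sum>i\<le>n. c 0 i)"
  define R where "R = (\<Sum>d\<le>K. \<Sum>i\<le>n. c (Suc d) i * 2 ^ (K - d))"
  have "(\<Sum>d\<le>Suc K. \<Sum>i\<le>n. c d i * 2 ^ (Suc K - d)) = s * 2 ^ Suc K + R"
    unfolding sum.atMost_Suc_shift R_def s_def by (simp add: sum_distrib_right)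
  with Suc.prems have e: "s * 2 ^ Suc K + R = N * 2 ^ Suc K" by simp
  then have "s * 2 ^ Suc K \<le> N * 2 ^ Suc K" by linarith
  then have sN: "s \<le> N" by simp
  have "R = (N - s) * 2 ^ Suc K" using e by (simp only: diff_mult_distrib)
  then have "R = (2 * (N - s)) * 2 ^ K" by simp
  from Suc.IH[of "\<lambda>d. c (Suc d)", OF this[unfolded R_def]] obtain us where
    us: "length us = 2 * (N - s)" "\<forall>t\<in>set us. no_back t \<and> labels t \<subseteq> {0..n}"
    "\<forall>i d. (\<Sum>t\<leftarrow>us. leaf_count t d i) = (if d \<le> K \<and> i \<le> n then c (Suc d) i else 0)" by blast
  obtain ts where ts: "length ts = s"
    "\<forall>t\<in>set ts. no_back t \<and> labels t \<subseteq> {0..n}"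
    "\<forall>i d. (\<Sum>t\<leftarrow>ts. leaf_count t d i) = (if d = 0 \<and> i \<le> n then c 0 i else 0)"
    using leaf_list[of "c 0" n] unfolding s_def by blast
  have ev: "even (length us)" using us by simp
  have "length (ts @ pair_up us) = N" using ts us sN by (simp add: length_pair_up)
  moreover have "\<forall>t\<in>set (ts @ pair_up us). no_back t \<and> labels t \<subseteq> {0..n}"
    using ts(2) pair_up_ok[OF ev us(2)] by auto
  moreover have "\<forall>i d. (\<Sum>t\<leftarrow>ts @ pair_up us. leaf_count t d i) =
      (if d \<le> Suc K \<and> i \<le> n then c d i else 0)"
    using ts(3) us(3) by (auto simp: pair_up_count[OF ev] split: nat.splits)
  ultimately show ?case by blast
qed

lemma binary_expansion:
  fixes A :: nat
  assumes "A < 2 ^ Suc K"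
  shows "(\<Sum>j\<le>K. (A div 2 ^ j mod 2) * 2 ^ j) = A"
  using assms
proof (induction K arbitrary: A)
  case 0
  then show ?case by simp
next
  case (Suc K)
  have "(\<Sum>j\<le>Suc K. (A div 2 ^ j mod 2) * 2 ^ j) =
      A mod 2 + 2 * (\<Sum>j\<le>K. (A div 2 div 2 ^ j mod 2) * 2 ^ j)"
    unfolding sum.atMost_Suc_shift
    by (simp add: sum_distrib_left div_mult2_eq mult_ac)
  also have "\<dots> = A" using Suc.IH[of "A div 2"] Suc.prems by simp
  finally show ?case .
qed

lemma bit_eps_dyadic:
  "bit_eps d (real A / 2 ^ K) = (if d \<le> K then int (A div 2 ^ (K - d) mod 2) else 0)"
proof (cases "d \<le> K")
  case True
  then have "(2::real) ^ K = 2 ^ d * 2 ^ (K - d)" by (simp flip: power_add)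
  then have "2 ^ d * (real A / 2 ^ K) = real A / real (2 ^ (K - d))"
    by simp
  then have "\<lfloor>2 ^ d * (real A / 2 ^ K)\<rfloor> = int (A div 2 ^ (K - d))"
    by (simp only: floor_divide_of_nat_eq)
  then show ?thesis using True by (simp add: bit_eps_def zmod_int)
next
  case False
  then obtain e where d: "d = Suc (K + e)" by (metis not_le less_iff_Suc_add)
  then have "2 ^ d * (real A / 2 ^ K) = real_of_int (2 * (2 ^ e * int A))"
    by (simp add: power_add)
  then have "\<lfloor>2 ^ d * (real A / 2 ^ K)\<rfloor> = 2 * (2 ^ e * int A)"
    by (simp only: floor_of_int)
  then show ?thesis using False by (simp add: bit_eps_def)
qed

lemma entropy_optimal_exists:
  fixes A :: "nat \<Rightarrow> nat"
  assumes "(\<Sum>i\<le>n. A i) = 2 ^ K"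
  shows "\<exists>T. entropy_optimal n (\<lambda>i. real (A i) / 2 ^ K) T"
proof -
  define c where "c = (\<lambda>d i. A i div 2 ^ (K - d) mod 2)"
  have bin: "(\<Sum>d\<le>K. c d i * 2 ^ (K - d)) = A i" if "i \<le> n" for i
  proof -
    have "A i \<le> (\<Sum>i\<le>n. A i)" using that by (intro member_le_sum) auto
    also have "\<dots> < 2 ^ Suc K" using assms by simp
    finally have "(\<Sum>j\<le>K. (A i div 2 ^ j mod 2) * 2 ^ j) = A i" by (rule binary_expansion)
    moreover have "(\<Sum>d\<le>K. c d i * 2 ^ (K - d)) = (\<Sum>j\<le>K. (A i div 2 ^ j mod 2) * 2 ^ j)"
      unfolding c_def
      by (rule sum.reindex_bij_witness[of _ "\<lambda>j. K - j" "\<lambda>j. K - j"]) auto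
    ultimately show ?thesis by simp
  qed
  have "(\<Sum>d\<le>K. \<Sum>i\<le>n. c d i * 2 ^ (K - d)) = (\<Sum>i\<le>n. \<Sum>d\<le>K. c d i * 2 ^ (K - d))"
    by (rule sum.swap)
  also have "\<dots> = 1 * 2 ^ K" using bin assms by simp
  finally obtain ts where ts: "length ts = 1" "\<forall>t\<in>set ts. no_back t \<and> labels t \<subseteq> {0..n}"
    "\<forall>i d. (\<Sum>t\<leftarrow>ts. leaf_count t d i) = (if d \<le> K \<and> i \<le> n then c d i else 0)"
    using kraft_forest by blast
  from ts(1) obtain T where "ts = [T]" by (auto simp: length_Suc_conv)
  with ts have "entropy_optimal n (\<lambda>i. real (A i) / 2 ^ K) T"
    by (auto simp: entropy_optimal_def bit_eps_dyadic c_def)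
  then show ?thesis by blast
qed

lemma FLDR_nonempty:
  assumes "(\<Sum>i = 1..n. A i) > 0"
  shows "FLDR n A \<noteq> {}"
proof -
  let ?M = "\<Sum>i = 1..n. A i"
  have "log 2 (real ?M) \<le> real (fldr_depth n A)"
    unfolding fldr_depth_def by linarith
  moreover have "real ?M > 0" using assms by (simp only: of_nat_0_less_iff)
  ultimately have "real ?M \<le> 2 powr real (fldr_depth n A)"
    by (subst (asm) log_le_iff) auto
  then have "real ?M \<le> real (2 ^ fldr_depth n A)" by (simp add: powr_realpow)
  then have M: "?M \<le> 2 ^ fldr_depth n A" by (simp only: of_nat_le_iff)
  have "(\<Sum>i\<le>n. fldr_weight n A i) = fldr_weight n A 0 + (\<Sum>i = 1..n. fldr_weight n A i)"
    by (simp add: atMost_atLeast0 sum.atLeast_Suc_atMost)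
  also have "(\<Sum>i = 1..n. fldr_weight n A i) = ?M"
    by (intro sum.cong) (auto simp: fldr_weight_def)
  finally have "(\<Sum>i\<le>n. fldr_weight n A i) = 2 ^ fldr_depth n A"
    using M by (simp add: fldr_weight_def)
  from entropy_optimal_exists[OF this] show ?thesis by (auto simp: FLDR_def)
qed

end

theory Submission imports Defs begin

text \<open>
  Write \<open>q\<close> for the probability of a restart. Conditioning on one pass through the tree gives
  \<open>E = (\<Sum>i\<le>n. \<nu>(q\<^sub>i)) + q E\<close>, so \<open>E = (\<Sum>i\<le>n. \<nu>(q\<^sub>i)) / (1 - q)\<close>. Dyadic \<open>x > 0\<close> satisfy the
  Knuth--Yao bounds \<open>H1 x \<le> \<nu>(x) < H1 x + 2 x\<close>, and the chain rule
  \<open>\<Sum>i\<ge>1. H1 (q\<^sub>i) = (1 - q) H(P) + H1 (1 - q)\<close> then yields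
  \<open>H(P) \<le> E < H(P) + 2 + (H1 (1 - q) + H1 q + 2 q) / (1 - q)\<close>.
  The amplification makes \<open>t = q / (1 - q)\<close> at most \<open>s = 2 powr (k - K)\<close>, and the last summand equals
  \<open>(1 + t) log (1 + t) + t log (1 / t) + 2 t \<le> 4 s + s log (1 / s)\<close>, by concavity of the logarithm.
\<close>

subsection \<open>Expected cost of a sampler with restarts\<close>

text \<open>Separating the current node \<open>t\<close> from the root \<open>T\<close> permits
  induction on subtrees while back edges still lead to \<open>T\<close>.\<close>

definition bits_from :: "ddg \<Rightarrow> ddg \<Rightarrow> bool stream \<Rightarrow> enat" where
  "bits_from T t \<omega> = (INF n \<in> {n. \<exists>i. ddg_run T t n \<omega> = Leaf i}. enat n)"

lemma bits_used_eq_bits_from: "bits_used T = bits_from T T"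
  by (simp add: fun_eq_iff bits_used_def bits_from_def)

lemma bits_from_Leaf: "bits_from T (Leaf j) \<omega> = 0"
proof -
  have "bits_from T (Leaf j) \<omega> \<le> enat 0"
    unfolding bits_from_def by (rule INF_lower) (simp add: enter_def)
  then show ?thesis by (simp add: zero_enat_def[symmetric])
qed

lemma bits_from_Back: "bits_from T Back = bits_from T T"
proof -
  have "ddg_run T Back n \<omega> = ddg_run T T n \<omega>" for n \<omega>
    by (cases n) (auto simp: enter_def)
  then show ?thesis by (simp add: fun_eq_iff bits_from_def)
qed

lemma bits_from_Node:
  "bits_from T (Node l r) \<omega> = eSuc (bits_from T (if shd \<omega> then r else l) (stl \<omega>))"
proof -
  let ?u = "if shd \<omega> then r else l"
  let ?X = "{n. \<exists>i. ddg_run T ?u n (stl \<omega>) = Leaf i}"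
  have "{n. \<exists>i. ddg_run T (Node l r) n \<omega> = Leaf i} = Suc ` ?X"
  proof (intro set_eqI)
    fix n
    show "n \<in> {n. \<exists>i. ddg_run T (Node l r) n \<omega> = Leaf i} \<longleftrightarrow> n \<in> Suc ` ?X"
      by (cases n) (auto simp: enter_def image_iff)
  qed
  then have "bits_from T (Node l r) \<omega> = (INF n\<in>?X. eSuc (enat n))"
    unfolding bits_from_def by (simp add: image_image eSuc_enat)
  also have "\<dots> = eSuc (INF n\<in>?X. enat n)"
  \<comment> \<open>If no leaf is ever reached, both infima are infinite. Otherwise the infimum is
    attained, since \<open>enat\<close> is well-ordered.\<close>
  proof (cases "?X = {}")
    case False
    show ?thesis
    proof (rule antisym)
      from False obtain n0 where n0: "n0 \<in> ?X" by blast
      have "(INF n\<in>?X. enat n) \<in> enat ` ?X"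
        using n0 by (intro wellorder_InfI) blast
      then obtain n where n: "n \<in> ?X" "(INF n\<in>?X. enat n) = enat n" by (rule imageE)
      show "(INF n\<in>?X. eSuc (enat n)) \<le> eSuc (INF n\<in>?X. enat n)"
        unfolding n(2) by (rule INF_lower[OF n(1)])
    qed (auto intro!: INF_greatest INF_lower simp del: mem_Collect_eq)
  qed (simp only: image_empty Inf_enat_def, simp)
  finally show ?thesis by (simp only: bits_from_def)
qed

lemma measurable_bits_from [measurable]:
  "(\<lambda>\<omega>. ennreal_of_enat (bits_from T t \<omega>)) \<in> borel_measurable fair_bits"
proof -
  have [measurable]: "ddg_run T t n \<in> measurable fair_bits (count_space UNIV)" for n
    by (rule measurable_ddg_run)
  \<comment> \<open>The index set depends on \<open>\<omega>\<close>. Assigning infinity to the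
    other \<open>n\<close> gives an infimum over all naturals, measurable term by term.\<close>
  have "bits_from T t = (\<lambda>\<omega>. INF n. if \<exists>i. ddg_run T t n \<omega> = Leaf i then enat n else \<infinity>)"
    (is "_ = ?g")
  proof (intro ext antisym)
    fix \<omega>
    show "bits_from T t \<omega> \<le> ?g \<omega>"
      unfolding bits_from_def by (rule INF_greatest) (auto intro: INF_lower)
    show "?g \<omega> \<le> bits_from T t \<omega>"
      unfolding bits_from_def
    proof (rule INF_greatest)
      fix j assume "j \<in> {n. \<exists>i. ddg_run T t n \<omega> = Leaf i}"
      then show "?g \<omega> \<le> enat j" by (intro INF_lower2[of j]) auto
    qed
  qed
  also have "?g \<in> measurable fair_bits (count_space UNIV)" by measurable
  finally show ?thesis by simp
qed

lemma prob_space_fair_bits: "prob_space fair_bits"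
  unfolding fair_bits_def by (intro prob_space.prob_space_stream_space) (rule prob_space_measure_pmf)

lemma nn_integral_fair_bits_Stream:
  assumes "f \<in> borel_measurable fair_bits"
  shows "(\<integral>\<^sup>+\<omega>. f \<omega> \<partial>fair_bits) =
    ennreal (1/2) * (\<integral>\<^sup>+\<omega>. f (False ## \<omega>) \<partial>fair_bits) +
    ennreal (1/2) * (\<integral>\<^sup>+\<omega>. f (True ## \<omega>) \<partial>fair_bits)"
proof -
  have "(\<integral>\<^sup>+\<omega>. f \<omega> \<partial>fair_bits) =
      (\<integral>\<^sup>+x. (\<integral>\<^sup>+\<omega>. f (x ## \<omega>) \<partial>fair_bits) \<partial>measure_pmf (bernoulli_pmf (1/2)))"
    using assms unfolding fair_bits_def by (rule prob_space.nn_integral_stream_space[OF prob_space_measure_pmf])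
  then show ?thesis by (simp add: mult.commute add.commute)
qed

text \<open>
  The restart equation \<open>E = mean_depth T + back_prob T * E\<close> is also satisfied by \<open>E = \<infinity>\<close>. Capping
  the cost at a finite \<open>c\<close> makes the expectation finite, and the bound obtained does not depend on \<open>c\<close>.
\<close>

definition trunc_cost :: "ennreal \<Rightarrow> ddg \<Rightarrow> ddg \<Rightarrow> ennreal" where
  "trunc_cost c T t = (\<integral>\<^sup>+\<omega>. min c (ennreal_of_enat (bits_from T t \<omega>)) \<partial>fair_bits)"

text \<open>The cap leaves only an inequality: \<open>min c (1 + x) \<le> 1 + min c x\<close> is
  strict once \<open>x\<close> reaches a finite \<open>c\<close>.\<close>

lemma trunc_cost_Node:
  "trunc_cost c T (Node l r) \<le> 1 + ennreal (1/2) * trunc_cost c T l + ennreal (1/2) * trunc_cost c T r"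
proof -
  interpret prob_space fair_bits by (rule prob_space_fair_bits)
  let ?b = "\<lambda>t \<omega>. min c (ennreal_of_enat (bits_from T t \<omega>))"
  have "min c (1 + x) \<le> 1 + min c x" for x :: ennreal
    by (cases "c \<le> x") (simp_all add: min.absorb1 min.absorb2 min.coboundedI1 min.coboundedI2)
  then have le: "?b (Node l r) (x ## \<omega>) \<le> 1 + ?b (if x then r else l) \<omega>" for x \<omega>
    by (simp add: bits_from_Node ennreal_of_enat_eSuc)
  have "(\<integral>\<^sup>+\<omega>. ?b (Node l r) (x ## \<omega>) \<partial>fair_bits) \<le> 1 + trunc_cost c T (if x then r else l)" for x
  proof -
    have "(\<integral>\<^sup>+\<omega>. ?b (Node l r) (x ## \<omega>) \<partial>fair_bits) \<le>
        (\<integral>\<^sup>+\<omega>. 1 + ?b (if x then r else l) \<omega> \<partial>fair_bits)"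
      by (intro nn_integral_mono le)
    also have "\<dots> = 1 + trunc_cost c T (if x then r else l)"
      unfolding trunc_cost_def by (subst nn_integral_add) (auto simp: emeasure_space_1)
    finally show ?thesis .
  qed
  from this[of False] this[of True]
  have "trunc_cost c T (Node l r) \<le> ennreal (1/2) * (1 + trunc_cost c T l) + ennreal (1/2) * (1 + trunc_cost c T r)"
    unfolding trunc_cost_def[of c T "Node l r"]
    by (subst nn_integral_fair_bits_Stream) (auto intro!: add_mono mult_left_mono)
  also have "\<dots> = (ennreal (1/2) + ennreal (1/2)) + ennreal (1/2) * trunc_cost c T l + ennreal (1/2) * trunc_cost c T r"
    by (simp only: distrib_left mult_1_right add.assoc add.left_commute)
  also have "ennreal (1/2) + ennreal (1/2) = 1" by (subst ennreal_plus[symmetric]) auto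
  finally show ?thesis .
qed

text \<open>At cap \<open>top\<close> the minimum disappears, so conditioning on the first bit gives
  an equality.\<close>

lemma trunc_cost_top_Node:
  "trunc_cost top T (Node l r) = 1 + ennreal (1/2) * trunc_cost top T l + ennreal (1/2) * trunc_cost top T r"
proof -
  interpret prob_space fair_bits by (rule prob_space_fair_bits)
  have "(\<integral>\<^sup>+\<omega>. ennreal_of_enat (bits_from T (Node l r) (x ## \<omega>)) \<partial>fair_bits) =
      1 + trunc_cost top T (if x then r else l)" for x
    unfolding trunc_cost_def bits_from_Node ennreal_of_enat_eSuc
    by (cases x; simp; subst nn_integral_add; simp add: emeasure_space_1)
  then have "trunc_cost top T (Node l r) =
      ennreal (1/2) * (1 + trunc_cost top T l) + ennreal (1/2) * (1 + trunc_cost top T r)"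
    unfolding trunc_cost_def[of top T "Node l r"]
    by (subst nn_integral_fair_bits_Stream) auto
  also have "\<dots> = (ennreal (1/2) + ennreal (1/2)) + ennreal (1/2) * trunc_cost top T l + ennreal (1/2) * trunc_cost top T r"
    by (simp only: distrib_left mult_1_right add.assoc add.left_commute)
  also have "ennreal (1/2) + ennreal (1/2) = 1" by (subst ennreal_plus[symmetric]) auto
  finally show ?thesis .
qed

text \<open>Expected number of bits in a single pass, which stops at a leaf or at a back edge alike;
  \<open>back_prob\<close> is the chance of the latter.\<close>

primrec mean_depth :: "ddg \<Rightarrow> real" where
  "mean_depth (Leaf j) = 0"
| "mean_depth Back = 0"
| "mean_depth (Node l r) = 1 + mean_depth l / 2 + mean_depth r / 2"

primrec back_prob :: "ddg \<Rightarrow> real" where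
  "back_prob (Leaf j) = 0"
| "back_prob Back = 1"
| "back_prob (Node l r) = back_prob l / 2 + back_prob r / 2"

lemma mean_depth_nonneg: "0 \<le> mean_depth t"
  by (induction t) auto

lemma back_prob_nonneg: "0 \<le> back_prob t"
  by (induction t) auto

lemma one_pass_Node:
  fixes E :: ennreal
  shows "1 + ennreal (1/2) * (ennreal (mean_depth l) + ennreal (back_prob l) * E) +
      ennreal (1/2) * (ennreal (mean_depth r) + ennreal (back_prob r) * E) =
    ennreal (mean_depth (Node l r)) + ennreal (back_prob (Node l r)) * E"
proof -
  have half: "ennreal (x / 2) = ennreal (1/2) * ennreal x" if "0 \<le> x" for x :: real
    using that by (simp flip: ennreal_mult del: ennreal_half)
  show ?thesis
    by (simp add: mean_depth_nonneg back_prob_nonneg half[OF mean_depth_nonneg]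
        half[OF back_prob_nonneg] algebra_simps del: ennreal_half)
qed

text \<open>Induction on \<open>t\<close> with the root \<open>T\<close> fixed: arriving at
  \<open>Back\<close> costs exactly as much as a fresh start at \<open>T\<close>.\<close>

lemma trunc_cost_le_one_pass:
  "trunc_cost c T t \<le> ennreal (mean_depth t) + ennreal (back_prob t) * trunc_cost c T T"
proof (induction t)
  case (Node l r)
  have "trunc_cost c T (Node l r) \<le> 1 + ennreal (1/2) * trunc_cost c T l + ennreal (1/2) * trunc_cost c T r"
    by (rule trunc_cost_Node)
  also have "\<dots> \<le> 1 + ennreal (1/2) * (ennreal (mean_depth l) + ennreal (back_prob l) * trunc_cost c T T) +
      ennreal (1/2) * (ennreal (mean_depth r) + ennreal (back_prob r) * trunc_cost c T T)"
    by (intro add_mono mult_left_mono Node order_refl) auto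
  finally show ?case unfolding one_pass_Node .
qed (simp_all add: trunc_cost_def bits_from_Leaf bits_from_Back)

lemma trunc_cost_top_one_pass:
  "trunc_cost top T t = ennreal (mean_depth t) + ennreal (back_prob t) * trunc_cost top T T"
proof (induction t)
  case (Node l r)
  show ?case
    by (subst trunc_cost_top_Node, subst Node(1), subst Node(2), rule one_pass_Node)
qed (simp_all add: trunc_cost_def bits_from_Leaf bits_from_Back)

lemma trunc_cost_bound:
  assumes "back_prob T < 1" "c < top"
  shows "trunc_cost c T T \<le> ennreal (mean_depth T / (1 - back_prob T))"
proof -
  interpret prob_space fair_bits by (rule prob_space_fair_bits)
  have "trunc_cost c T T \<le> (\<integral>\<^sup>+\<omega>. c \<partial>fair_bits)"
    unfolding trunc_cost_def by (intro nn_integral_mono) simp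
  then have "trunc_cost c T T < top" using assms(2) by (simp add: emeasure_space_1)
  then obtain x where x: "trunc_cost c T T = ennreal x" "0 \<le> x"
    by (cases "trunc_cost c T T") auto
  have "ennreal x \<le> ennreal (mean_depth T + back_prob T * x)"
    using trunc_cost_le_one_pass[of c T T] x
    by (simp add: ennreal_plus ennreal_mult mean_depth_nonneg back_prob_nonneg)
  then have "x \<le> mean_depth T + back_prob T * x"
    using x by (subst (asm) ennreal_le_iff) (auto simp: mean_depth_nonneg back_prob_nonneg)
  then have "x \<le> mean_depth T / (1 - back_prob T)"
    using assms(1) by (simp add: field_simps)
  then show ?thesis using x by (simp add: ennreal_leI)
qed

text \<open>Monotone convergence over integer caps shows that the expectation is finite; the exact
  restart equation can then be solved in the reals.\<close>

lemma expected_cost_eq: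
  assumes "back_prob T < 1"
  shows "expected_cost T = ennreal (mean_depth T / (1 - back_prob T))"
proof -
  let ?f = "\<lambda>\<omega>. ennreal_of_enat (bits_from T T \<omega>)"
  have E: "expected_cost T = trunc_cost top T T"
    by (simp add: expected_cost_def trunc_cost_def bits_used_eq_bits_from)
  have sup: "(SUP n. min (of_nat n) y) = y" for y :: ennreal
  proof -
    have "(SUP n. min (of_nat n) y) = (SUP n. inf y (of_nat n))"
      by (simp add: inf_min min.commute)
    also have "\<dots> = inf y (SUP n. of_nat n)" by (rule inf_SUP[symmetric])
    also have "(SUP n. of_nat n :: ennreal) = top" by (rule ennreal_SUP_of_nat_eq_top)
    finally show ?thesis by simp
  qed
  have "trunc_cost top T T = (\<integral>\<^sup>+\<omega>. (SUP n. min (of_nat n) (?f \<omega>)) \<partial>fair_bits)"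
    by (simp add: sup trunc_cost_def)
  also have "\<dots> = (SUP n. trunc_cost (of_nat n) T T)"
    unfolding trunc_cost_def
    by (intro nn_integral_monotone_convergence_SUP)
      (auto intro!: incseq_SucI le_funI min.mono simp: add_increasing)
  also have "\<dots> \<le> ennreal (mean_depth T / (1 - back_prob T))"
    by (intro SUP_least trunc_cost_bound assms) (simp add: of_nat_less_top)
  finally have "trunc_cost top T T < top" using order_le_less_trans ennreal_less_top by blast
  then obtain x where x: "trunc_cost top T T = ennreal x" "0 \<le> x"
    by (cases "trunc_cost top T T") auto
  have "ennreal x = ennreal (mean_depth T + back_prob T * x)"
    using trunc_cost_top_one_pass[of T T] x
    by (simp add: ennreal_plus ennreal_mult mean_depth_nonneg back_prob_nonneg)
  then have "x = mean_depth T + back_prob T * x"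
    using x by (subst (asm) ennreal_inj) (auto simp: mean_depth_nonneg back_prob_nonneg)
  then have "x = mean_depth T / (1 - back_prob T)"
    using assms(1) by (simp add: field_simps)
  then show ?thesis using x E by simp
qed

subsection \<open>The binary cost function\<close>

text \<open>\<open>nu K N\<close> is the paper's \<open>\<nu>(N / 2^K)\<close>.\<close>

definition nu :: "nat \<Rightarrow> nat \<Rightarrow> real" where
  "nu K N = (\<Sum>d\<le>K. real d * real (N div 2 ^ (K - d) mod 2) / 2 ^ d)"

text \<open>The toll \<open>\<nu>(x) - H1 x\<close> at \<open>x = N / 2^K\<close> is \<open>(N log N - bit_moment K N) / 2^K\<close>.\<close>

definition bit_moment :: "nat \<Rightarrow> nat \<Rightarrow> real" where
  "bit_moment K N = (\<Sum>j\<le>K. real j * real (N div 2 ^ j mod 2) * 2 ^ j)"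

text \<open>Bit positions up to \<open>K\<close> inclusive cover the case \<open>N = 2 ^ K\<close>,
  that is, probability 1.\<close>

lemma binary_expansion_real:
  assumes "N < 2 ^ Suc K"
  shows "(\<Sum>j\<le>K. real (N div 2 ^ j mod 2) * 2 ^ j) = real N"
proof -
  have "(\<Sum>j\<le>K. real (N div 2 ^ j mod 2) * 2 ^ j) = real (\<Sum>j\<le>K. (N div 2 ^ j mod 2) * 2 ^ j)"
    by simp
  then show ?thesis using binary_expansion[OF assms] by simp
qed

lemma sum_bits_reverse:
  fixes f :: "nat \<Rightarrow> real"
  shows "(\<Sum>d\<le>K. f (K - d) / 2 ^ d) = (\<Sum>j\<le>K. f j * 2 ^ j) / 2 ^ K"
proof -
  have "(\<Sum>d\<le>K. f (K - d) / 2 ^ d) = (\<Sum>j\<le>K. f j / 2 ^ (K - j))"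
    by (rule sum.reindex_bij_witness[of _ "\<lambda>j. K - j" "\<lambda>j. K - j"]) auto
  also have "\<dots> = (\<Sum>j\<le>K. f j * 2 ^ j / 2 ^ K)"
    by (intro sum.cong) (auto simp: power_diff)
  finally show ?thesis by (simp add: sum_divide_distrib)
qed

text \<open>Reading bits from the low end, depth \<open>d\<close> becomes \<open>K - j\<close>; the
  constant part \<open>K\<close> multiplies the binary expansion of \<open>N\<close>.\<close>

lemma nu_eq_bit_moment:
  assumes "N < 2 ^ Suc K"
  shows "nu K N = (real K * real N - bit_moment K N) / 2 ^ K"
proof -
  have "nu K N = (\<Sum>d\<le>K. (real K - real (K - d)) * real (N div 2 ^ (K - d) mod 2) / 2 ^ d)"
    unfolding nu_def by (intro sum.cong) auto
  also have "\<dots> = (\<Sum>j\<le>K. (real K - real j) * real (N div 2 ^ j mod 2) * 2 ^ j) / 2 ^ K"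
    by (rule sum_bits_reverse)
  also have "(\<Sum>j\<le>K. (real K - real j) * real (N div 2 ^ j mod 2) * 2 ^ j) =
      real K * (\<Sum>j\<le>K. real (N div 2 ^ j mod 2) * 2 ^ j) - bit_moment K N"
    unfolding bit_moment_def sum_distrib_left sum_subtractf[symmetric]
    by (intro sum.cong) (auto simp: algebra_simps)
  finally show ?thesis unfolding binary_expansion_real[OF assms] .
qed

section \<open>Knuth--Yao bounds for dyadic probabilities\<close>

text \<open>A set bit \<open>j\<close> forces \<open>2 ^ j \<le> N\<close>, so each weight
  \<open>j\<close> is at most \<open>log 2 N\<close>, and the weighted bits sum to
  \<open>N\<close>.\<close>

lemma bit_moment_le:
  assumes "N < 2 ^ Suc K" "0 < N"
  shows "bit_moment K N \<le> real N * log 2 (real N)"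
proof -
  have "bit_moment K N \<le> (\<Sum>j\<le>K. log 2 (real N) * (real (N div 2 ^ j mod 2) * 2 ^ j))"
    unfolding bit_moment_def
  proof (intro sum_mono)
    fix j
    show "real j * real (N div 2 ^ j mod 2) * 2 ^ j \<le> log 2 (real N) * (real (N div 2 ^ j mod 2) * 2 ^ j)"
    proof (cases "N div 2 ^ j mod 2 = 0")
      case False
      then have "2 ^ j \<le> N" by (metis div_less mod_0 not_le)
      then have "(2::real) ^ j \<le> real N" by (metis of_nat_le_iff of_nat_numeral of_nat_power)
      then have "real j \<le> log 2 (real N)" using assms(2) by (simp add: le_log_iff powr_realpow)
      then show ?thesis unfolding mult.assoc by (intro mult_right_mono) auto
    qed (simp only: of_nat_0 mult_zero_left mult_zero_right order_refl)
  qed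
  also have "\<dots> = log 2 (real N) * real N"
    by (simp only: binary_expansion_real[OF assms(1)] sum_distrib_left[symmetric])
  finally show ?thesis by (simp add: mult.commute)
qed

lemma log2_le_linear:
  assumes "0 < (x::real)"
  shows "log 2 x \<le> 3 / 2 * \<bar>x - 1\<bar>"
proof -
  have "ln x \<le> \<bar>x - 1\<bar>" using ln_le_minus_one[OF assms] by linarith
  \<comment> \<open>The constant \<open>3 / 2\<close> bounds \<open>1 / ln 2\<close>; the absolute
    value keeps the factor nonnegative for \<open>x < 1\<close>.\<close>
  moreover have "\<bar>x - 1\<bar> * 1 \<le> \<bar>x - 1\<bar> * (3 / 2 * ln 2)"
    using ln2_ge_two_thirds by (intro mult_left_mono) auto
  ultimately have "ln x \<le> 3 / 2 * \<bar>x - 1\<bar> * ln 2" by (simp add: mult_ac)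
  then show ?thesis by (simp add: log_def divide_le_eq)
qed

text \<open>
  The induction strips the leading bit: for \<open>N = p + R\<close> with \<open>R < p\<close> and \<open>p\<close> a power of 2, both
  \<open>p log (N / p)\<close> and \<open>R log (N / R)\<close> are at most \<open>p\<close>.
\<close>

lemma bit_moment_lower:
  assumes "N < 2 ^ Suc K" "0 < N"
  shows "real N * log 2 (real N) - 2 * real N < bit_moment K N"
  using assms
proof (induction K arbitrary: N)
  case 0
  then have "N = 1" by simp
  then show ?case by (simp add: bit_moment_def)
next
  case (Suc K)
  show ?case
  proof (cases "N < 2 ^ Suc K")
    case True
    then have "bit_moment (Suc K) N = bit_moment K N" by (simp add: bit_moment_def)
    then show ?thesis using Suc.IH[OF True] Suc.prems by simp
  next
    case False
    define p where "p = (2::nat) ^ Suc K"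
    define R where "R = N - p"
    have NR: "N = p + R" "R < p" using False Suc.prems by (auto simp: R_def p_def)
    have p: "0 < p" by (simp add: p_def)
    have lp: "log 2 (real p) = real (Suc K)" unfolding p_def by (simp only: of_nat_power log_nat_power) simp
    have "N div 2 ^ j mod 2 = R div 2 ^ j mod 2" if "j \<le> K" for j
    proof -
      \<comment> \<open>Below the leading position \<open>p\<close> contributes an even multiple of
        \<open>2 ^ j\<close>, which leaves bit \<open>j\<close> unchanged.\<close>
      have "p = 2 ^ j * (2 * 2 ^ (K - j))"
        using that by (simp add: p_def power_add[symmetric])
      then have "N div 2 ^ j = 2 * 2 ^ (K - j) + R div 2 ^ j"
        unfolding NR(1) by (simp add: div_mult_self4)
      then show ?thesis by simp
    qed
    moreover have "N div p mod 2 = 1" using NR p by (simp add: div_add1_eq)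
    ultimately have bm: "bit_moment (Suc K) N = bit_moment K R + real (Suc K) * real p"
      unfolding bit_moment_def p_def by (simp add: algebra_simps)
    have lN: "real p * log 2 (real N) < real p * (1 + log 2 (real p))"
    proof -
      have "log 2 (real N) < log 2 (2 * real p)" using NR p by simp
      then show ?thesis using p by (simp add: log_mult)
    qed
    show ?thesis
    proof (cases "R = 0")
      case True
      then have "bit_moment K R = 0" by (simp add: bit_moment_def)
      then show ?thesis using bm lp NR True p by (simp add: algebra_simps)
    next
      case False
      then have "log 2 (real N / real R) \<le> real p / real R"
      proof -
        \<comment> \<open>Since \<open>N / R > 2\<close>, one factor 2 is split off before
          linearizing. The bound becomes \<open>1 / 4 + 3 / 4 * (p / R)\<close>, and
          \<open>p / R > 1\<close>.\<close>
        have "log 2 (real N / real R) = 1 + log 2 (real N / real R / 2)"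
          using NR False by (simp add: log_divide log_mult)
        also have "\<dots> \<le> 1 + 3 / 2 * \<bar>real N / real R / 2 - 1\<bar>"
          using NR False by (intro add_left_mono log2_le_linear) auto
        also have "\<dots> \<le> real p / real R" using NR False by (simp add: field_simps abs_if)
        finally show ?thesis .
      qed
      then have "real R * log 2 (real N / real R) \<le> real p" using False by (simp add: field_simps)
      then have "real R * log 2 (real N) \<le> real R * log 2 (real R) + real p"
        using NR False by (simp add: log_divide algebra_simps)
      moreover have "real R * log 2 (real R) - 2 * real R < bit_moment K R"
        using NR False by (intro Suc.IH) (auto simp: p_def)
      moreover have "real N * log 2 (real N) = real p * log 2 (real N) + real R * log 2 (real N)"
        by (simp add: NR(1) algebra_simps)
      ultimately show ?thesis using lN bm lp NR(1) by (simp add: algebra_simps)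
    qed
  qed
qed

lemma H1_dyadic:
  assumes "0 < N"
  shows "H1 (real N / 2 ^ K) = (real K * real N - real N * log 2 (real N)) / 2 ^ K"
  using assms by (simp add: H1_def log_divide log_nat_power field_simps)

lemma H1_le_nu:
  assumes "N \<le> 2 ^ K"
  shows "H1 (real N / 2 ^ K) \<le> nu K N"
proof (cases "N = 0")
  case False
  have "N < 2 ^ Suc K" using assms by (simp add: le_less_trans)
  with bit_moment_le[OF this] False show ?thesis
    by (simp add: H1_dyadic nu_eq_bit_moment divide_right_mono)
qed (simp add: H1_def nu_def)

lemma nu_less:
  assumes "N \<le> 2 ^ K" "0 < N"
  shows "nu K N < H1 (real N / 2 ^ K) + 2 * (real N / 2 ^ K)"
proof -
  have "N < 2 ^ Suc K" using assms by (simp add: le_less_trans)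
  then have "nu K N < (real K * real N - real N * log 2 (real N) + 2 * real N) / 2 ^ K"
    using bit_moment_lower[of N K] assms(2) by (simp add: nu_eq_bit_moment divide_strict_right_mono)
  then show ?thesis using assms(2) by (simp add: H1_dyadic add_divide_distrib)
qed

lemma nu_zero: "nu K 0 = 0" by (simp add: nu_def)

subsection \<open>Counting leaves\<close>

text \<open>Hanging a subtree one level lower shifts the weight from \<open>g d\<close> to
  \<open>g (Suc d)\<close>. A general \<open>g\<close> serves both the Kraft sum and the mean
  depth.\<close>

lemma sum_leaf_count_Node:
  fixes g :: "nat \<Rightarrow> real"
  shows "(\<Sum>d\<le>Suc N. g d * real (leaf_count (Node l r) d i)) =
    (\<Sum>d\<le>N. g (Suc d) * real (leaf_count l d i)) + (\<Sum>d\<le>N. g (Suc d) * real (leaf_count r d i))"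
  unfolding sum.atMost_Suc_shift by (simp add: sum.distrib algebra_simps)

lemma sum_sum_leaf_count_Node:
  fixes g :: "nat \<Rightarrow> real"
  shows "(\<Sum>i\<in>S. \<Sum>d\<le>Suc N. g d * real (leaf_count (Node l r) d i)) =
    (\<Sum>i\<in>S. \<Sum>d\<le>N. g (Suc d) * real (leaf_count l d i)) +
    (\<Sum>i\<in>S. \<Sum>d\<le>N. g (Suc d) * real (leaf_count r d i))"
  unfolding sum_leaf_count_Node by (rule sum.distrib)

lemma sum_leaf_count_Leaf:
  fixes g :: "nat \<Rightarrow> real"
  shows "(\<Sum>d\<le>N. g d * real (leaf_count (Leaf j) d i)) = (if i = j then g 0 else 0)"
proof -
  have "(\<Sum>d\<le>N. g d * real (leaf_count (Leaf j) d i)) = (\<Sum>d\<le>N. if d = 0 then (if i = j then g 0 else 0) else 0)"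
    by (intro sum.cong) auto
  then show ?thesis by simp
qed

text \<open>Each level down halves the weights, so a node averages its children's sums. The size
  bounds the depth, so the truncation at \<open>N\<close> loses no leaf.\<close>

lemma kraft_equality:
  assumes "no_back t" "labels t \<subseteq> S" "finite S" "size t \<le> N"
  shows "(\<Sum>i\<in>S. \<Sum>d\<le>N. 1 / 2 ^ d * real (leaf_count t d i)) = 1"
  using assms
proof (induction t arbitrary: N)
  case (Node l r)
  then obtain N' where N: "N = Suc N'" "size l \<le> N'" "size r \<le> N'" by (cases N) auto
  have half: "(\<Sum>i\<in>S. \<Sum>d\<le>N'. 1 / 2 ^ Suc d * real (leaf_count t d i)) =
      (\<Sum>i\<in>S. \<Sum>d\<le>N'. 1 / 2 ^ d * real (leaf_count t d i)) / 2" for t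
    by (simp add: sum_divide_distrib mult.commute)
  show ?case
    unfolding N(1) sum_sum_leaf_count_Node half using Node.IH[of N'] Node.prems N by simp
next
  case (Leaf j)
  then show ?case unfolding sum_leaf_count_Leaf by simp
qed simp

lemma mean_depth_eq_sum:
  assumes "no_back t" "labels t \<subseteq> S" "finite S" "size t \<le> N"
  shows "mean_depth t = (\<Sum>i\<in>S. \<Sum>d\<le>N. real d / 2 ^ d * real (leaf_count t d i))"
  using assms
proof (induction t arbitrary: N)
  case (Node l r)
  then obtain N' where N: "N = Suc N'" "size l \<le> N'" "size r \<le> N'" by (cases N) auto
  \<comment> \<open>Of \<open>Suc d\<close>, the part \<open>d\<close> gives half the child's mean
    depth and the part 1 half its Kraft sum; the two Kraft halves make up the bit spent at the
    node.\<close>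
  have "(\<Sum>i\<in>S. \<Sum>d\<le>N'. real (Suc d) / 2 ^ Suc d * real (leaf_count t d i)) =
      (\<Sum>i\<in>S. \<Sum>d\<le>N'. real d / 2 ^ d * real (leaf_count t d i)) / 2 +
      (\<Sum>i\<in>S. \<Sum>d\<le>N'. 1 / 2 ^ d * real (leaf_count t d i)) / 2" for t
    unfolding sum_divide_distrib sum.distrib[symmetric]
    by (intro sum.cong refl) (simp add: field_simps)
  then show ?case
    unfolding N(1) sum_sum_leaf_count_Node
    using Node.IH[of N'] Node.prems N kraft_equality[of l S N'] kraft_equality[of r S N'] by simp
next
  case (Leaf j)
  then show ?case unfolding sum_leaf_count_Leaf by simp
qed simp

lemma back_prob_reject_zero:
  assumes "no_back t" "size t \<le> N"
  shows "back_prob (reject_zero t) = (\<Sum>d\<le>N. 1 / 2 ^ d * real (leaf_count t d 0))"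
  using assms
proof (induction t arbitrary: N)
  case (Node l r)
  then obtain N' where N: "N = Suc N'" "size l \<le> N'" "size r \<le> N'" by (cases N) auto
  have half: "(\<Sum>d\<le>N'. 1 / 2 ^ Suc d * real (leaf_count t d 0)) =
      (\<Sum>d\<le>N'. 1 / 2 ^ d * real (leaf_count t d 0)) / 2" for t
    by (simp add: sum_divide_distrib mult.commute)
  show ?case
    unfolding N(1) sum_leaf_count_Node half using Node.IH[of N'] Node.prems N by simp
next
  case (Leaf j)
  then show ?case unfolding sum_leaf_count_Leaf by simp
qed simp

lemma mean_depth_reject_zero: "mean_depth (reject_zero t) = mean_depth t"
  by (induction t) auto

text \<open>The leaf counts are the binary digits of the \<open>W i\<close>, so weighting them by
  \<open>1 / 2 ^ d\<close> recovers the probability and by \<open>d / 2 ^ d\<close> the cost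
  \<open>nu\<close>.\<close>

lemma entropy_optimal_dyadic:
  fixes W :: "nat \<Rightarrow> nat"
  assumes T: "entropy_optimal n (\<lambda>i. real (W i) / 2 ^ K) T"
    and W0: "W 0 \<le> 2 ^ K"
  shows "back_prob (reject_zero T) = real (W 0) / 2 ^ K"
    and "mean_depth (reject_zero T) = (\<Sum>i = 0..n. nu K (W i))"
proof -
  \<comment> \<open>Large enough to exceed every leaf depth and to contain all digit positions;
    counts beyond \<open>K\<close> vanish.\<close>
  define N where "N = K + size T"
  have lc: "leaf_count T d i = (if d \<le> K then W i div 2 ^ (K - d) mod 2 else 0)" if "i \<le> n" for d i
  proof -
    have "int (leaf_count T d i) = bit_eps d (real (W i) / 2 ^ K)"
      using T that by (simp add: entropy_optimal_def)
    then show ?thesis unfolding bit_eps_dyadic by (auto split: if_splits)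
  qed
  have sum: "(\<Sum>d\<le>N. g d * real (leaf_count T d i)) = (\<Sum>d\<le>K. g d * real (W i div 2 ^ (K - d) mod 2))"
    if "i \<le> n" for g :: "nat \<Rightarrow> real" and i
    by (rule sum.mono_neutral_cong_right) (auto simp: N_def lc[OF that])
  have "back_prob (reject_zero T) = (\<Sum>d\<le>N. 1 / 2 ^ d * real (leaf_count T d 0))"
    using T by (intro back_prob_reject_zero) (auto simp: entropy_optimal_def N_def)
  also have "\<dots> = (\<Sum>d\<le>K. real (W 0 div 2 ^ (K - d) mod 2) / 2 ^ d)"
    unfolding sum[OF le0] by simp
  also have "\<dots> = (\<Sum>j\<le>K. real (W 0 div 2 ^ j mod 2) * 2 ^ j) / 2 ^ K"
    by (rule sum_bits_reverse)
  also have "\<dots> = real (W 0) / 2 ^ K"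
    using W0 by (subst binary_expansion_real) (auto intro: le_less_trans)
  finally show "back_prob (reject_zero T) = real (W 0) / 2 ^ K" .
  have "mean_depth T = (\<Sum>i\<in>{0..n}. \<Sum>d\<le>N. real d / 2 ^ d * real (leaf_count T d i))"
    using T by (intro mean_depth_eq_sum) (auto simp: entropy_optimal_def N_def)
  also have "\<dots> = (\<Sum>i = 0..n. nu K (W i))"
    by (intro sum.cong refl) (subst sum, auto simp: nu_def)
  finally show "mean_depth (reject_zero T) = (\<Sum>i = 0..n. nu K (W i))"
    by (simp add: mean_depth_reject_zero)
qed

subsection \<open>The price of rejection\<close>

text \<open>Product rule behind the entropy chain rule: \<open>x\<close> will be
  \<open>1 - q\<close> and \<open>y\<close> will run over the \<open>P i\<close>.\<close>

lemma H1_mult: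
  assumes "0 < x" "0 < y"
  shows "H1 (x * y) = x * H1 y + y * H1 x"
  using assms by (simp add: H1_def log_divide log_mult algebra_simps)

lemma H1_nonneg: "0 \<le> x \<Longrightarrow> x \<le> 1 \<Longrightarrow> 0 \<le> H1 x"
  by (simp add: H1_def)

lemma one_plus_log2_le:
  fixes t :: real
  assumes "0 \<le> t" "t \<le> 1"
  shows "(1 + t) * log 2 (1 + t) \<le> 2 * t"
proof -
  \<comment> \<open>\<open>v\<close> places \<open>1 / (1 + t)\<close> on the segment from
    \<open>1/2\<close> to 1; the chord of \<open>- log 2\<close> there gives
    \<open>log 2 (1 + t) \<le> 2 * t / (1 + t)\<close>.\<close>
  define v where "v = 2 / (1 + t) - 1"
  have v: "0 \<le> v" "v \<le> 1" using assms by (auto simp: v_def field_simps)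
  have "convex_on {0<..} (\<lambda>x. - log 2 x)" by (rule minus_log_convex) simp
  from convex_onD[OF this, of v "1/2" 1] v
  have "- log 2 (1 / (1 + t)) \<le> 1 - v"
    using assms by (simp add: v_def log_divide field_simps)
  then show ?thesis using assms by (simp add: v_def log_divide field_simps)
qed

text \<open>With \<open>t = q / (1 - q)\<close> the left-hand side, divided by \<open>1 - q\<close>, is
  \<open>(1 + t) log (1 + t) + t log (1 / t) + 2 t\<close>.\<close>

lemma rejection_overhead:
  fixes q :: real
  assumes "0 \<le> q" "q < 1" and q: "q \<le> (1 - q) * (1 / 2 ^ D)"
  shows "H1 (1 - q) + H1 q + 2 * q \<le> (1 - q) * ((4 + real D) * (1 / 2 ^ D))"
proof (cases "q = 0")
  case False
  define s :: real where "s = 1 / 2 ^ D"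
  define t where "t = q / (1 - q)"
  have s: "0 < s" "s \<le> 1" "log 2 s = - real D" by (auto simp: s_def log_divide log_nat_power)
  have t: "0 < t" "t \<le> s" using assms False by (auto simp: t_def s_def field_simps)
  have w: "1 - q = 1 / (1 + t)" "q = t / (1 + t)"
    using assms by (auto simp: t_def field_simps)
  \<comment> \<open>Comparing \<open>t\<close> with \<open>s\<close> isolates
    \<open>log 2 s = - D\<close>, so that only the ratio \<open>s / t\<close> has to be
    estimated.\<close>
  have "t * log 2 (s / t) \<le> t * (3 / 2 * \<bar>s / t - 1\<bar>)"
    using t s by (intro mult_left_mono log2_le_linear) auto
  also have "\<dots> \<le> 2 * (s - t)" using t by (simp add: field_simps)
  finally have "- t * log 2 t \<le> 2 * (s - t) + t * real D"
    using t s by (simp add: log_divide algebra_simps)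
  moreover have "t * real D \<le> s * real D" using t by (intro mult_right_mono) auto
  moreover have "(1 + t) * log 2 (1 + t) \<le> 2 * t" using t s by (intro one_plus_log2_le) auto
  ultimately have "(1 + t) * log 2 (1 + t) - t * log 2 t + 2 * t \<le> (4 + real D) * s"
    using t by (simp add: algebra_simps)
  moreover have "H1 (1 - q) + H1 q + 2 * q = ((1 + t) * log 2 (1 + t) - t * log 2 t + 2 * t) * (1 / (1 + t))"
  proof -
    have "H1 (1 - q) = log 2 (1 + t) * (1 / (1 + t))"
      unfolding w(1) using t by (simp add: H1_def)
    moreover have "H1 q = t * (log 2 (1 + t) - log 2 t) * (1 / (1 + t))"
      unfolding w(2) using t by (simp add: H1_def log_divide)
    moreover have "2 * q = 2 * t * (1 / (1 + t))" unfolding w(2) by simp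
    ultimately have "H1 (1 - q) + H1 q + 2 * q =
        (log 2 (1 + t) + t * (log 2 (1 + t) - log 2 t) + 2 * t) * (1 / (1 + t))"
      by (simp only: distrib_right)
    then show ?thesis by (simp add: algebra_simps)
  qed
  moreover have "0 \<le> 1 / (1 + t)" using t by simp
  ultimately show ?thesis
    unfolding w(1) s_def[symmetric] by (metis mult.commute mult_right_mono)
qed (auto simp: H1_def)

section \<open>Cost bounds for the amplified weights\<close>

theorem theorem4p6:
  fixes a :: "nat \<Rightarrow> nat" and n m k K :: nat and P :: "nat \<Rightarrow> real" and T :: ddg
  assumes "n \<ge> 1"
    and "\<forall>i\<in>{1..n}. a i > 0"
    and "Gcd (a ` {1..n}) = 1"
    and "m = (\<Sum>i = 1..n. a i)"
    and "P = (\<lambda>i. real (a i) / real m)"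
    and "k = nat \<lceil>log 2 (real m)\<rceil>"
    and "K \<ge> k"
    and "T \<in> ALDR n a K"
  shows "ennreal (shannon n P) \<le> expected_cost T \<and>
    expected_cost T <
      ennreal (shannon n P + 2 + (4 + real K - real k) * 2 powr (real k - real K))"
proof -
  define c where "c = 2 ^ K div m"
  define W where "W = fldr_weight n (\<lambda>i. c * a i)"
  define q where "q = real (W 0) / 2 ^ K"
  have "a 1 \<le> m" unfolding assms(4) using assms(1) by (intro member_le_sum) auto
  moreover have "0 < a 1" using assms(1,2) by simp
  ultimately have m: "0 < m" by linarith
  have "log 2 (real m) \<le> real k" unfolding assms(6) by linarith
  then have "real m \<le> 2 powr real k" using m by (subst (asm) log_le_iff) auto
  then have "real m \<le> real (2 ^ k)" by (simp add: powr_realpow)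
  then have mk: "m \<le> 2 ^ k" by (simp only: of_nat_le_iff)
  have D: "(2::nat) ^ K = 2 ^ (K - k) * 2 ^ k" using assms(7) by (simp flip: power_add)
  have cD: "2 ^ (K - k) \<le> c"
  proof -
    have "2 ^ (K - k) * m \<le> 2 ^ K" unfolding D using mk by simp
    then show ?thesis unfolding c_def using m by (simp add: less_eq_div_iff_mult_less_eq)
  qed
  then have c: "0 < c" by (metis gr0I not_le zero_less_numeral zero_less_power)
  define r where "r = 2 ^ K mod m"
  have cm: "c * m + r = 2 ^ K" by (simp add: c_def r_def)
  have r: "r < m" using m by (simp add: r_def)
  have M: "(\<Sum>i = 1..n. c * a i) = c * m" by (simp add: assms(4) sum_distrib_left)
  \<comment> \<open>The remainder satisfies \<open>r < m \<le> c * m\<close>, so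
    \<open>c * m\<close> exceeds half of \<open>2 ^ K\<close> and the ceiling is exactly
    \<open>K\<close>. The rejected weight is therefore \<open>r\<close>.\<close>
  have depth: "fldr_depth n (\<lambda>i. c * a i) = K"
  proof -
    have "m \<le> c * m" using c by simp
    then have "2 ^ K < 2 * (c * m)" using cm r by linarith
    then have "real (2 ^ K) < real (2 * (c * m))" by (simp only: of_nat_less_iff)
    then have "log 2 (2 ^ K) < log 2 (2 * real (c * m))"
      using c m by (subst log_less_cancel_iff) auto
    then have "real K - 1 < log 2 (real (c * m))"
      using c m by (simp add: log_nat_power log_mult)
    moreover have "real (c * m) \<le> real (2 ^ K)" unfolding of_nat_le_iff using cm by linarith
    then have "log 2 (real (c * m)) \<le> log 2 (2 ^ K)"
      using c m by (subst log_le_cancel_iff) auto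
    then have "log 2 (real (c * m)) \<le> real K" by (simp add: log_nat_power)
    ultimately have "\<lceil>log 2 (real (c * m))\<rceil> = int K" by linarith
    then show ?thesis unfolding fldr_depth_def M by simp
  qed
  have W0: "W 0 = r" using cm M unfolding W_def fldr_weight_def depth by simp
  have Wi: "W i = c * a i" if "i \<in> {1..n}" for i using that by (simp add: W_def fldr_weight_def)
  obtain T' where T: "T = reject_zero T'" and T': "entropy_optimal n (\<lambda>i. real (W i) / 2 ^ K) T'"
    using assms(8) unfolding ALDR_def FLDR_def assms(4)[symmetric] c_def[symmetric] W_def depth by blast
  have "W 0 \<le> 2 ^ K" using W0 cm by simp
  note cost = entropy_optimal_dyadic[OF T' this, folded T]
  have w: "1 - q = real (c * m) / 2 ^ K"
  proof -
    have "real (c * m) + real r = 2 ^ K" by (metis cm of_nat_add of_nat_numeral of_nat_power)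
    then show ?thesis unfolding q_def W0 by (simp add: field_simps)
  qed
  have w0: "0 < 1 - q" unfolding w using c m by simp
  have q0: "0 \<le> q" by (simp add: q_def)
  have bp: "back_prob T = q" using cost(1) by (simp add: q_def)
  have cost2: "mean_depth T = nu K r + (\<Sum>i = 1..n. nu K (c * a i))"
    unfolding cost(2) using Wi W0 by (simp add: sum.atLeast_Suc_atMost)
  have E: "expected_cost T = ennreal (mean_depth T / (1 - q))"
    using expected_cost_eq[of T] bp w0 by simp
  have Pi: "real (c * a i) / 2 ^ K = (1 - q) * P i" for i
    unfolding w assms(5) using m by simp
  have Ppos: "0 < P i" if "i \<in> {1..n}" for i using that assms(2) m by (simp add: assms(5))
  have Psum: "(\<Sum>i = 1..n. P i) = 1"
  proof -
    have "(\<Sum>i = 1..n. P i) = real (\<Sum>i = 1..n. a i) / real m"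
      by (simp add: assms(5) sum_divide_distrib)
    then show ?thesis using m unfolding assms(4)[symmetric] by simp
  qed
  \<comment> \<open>Chain rule: accepted outcomes have probabilities \<open>(1 - q) * P i\<close>,
    and the \<open>P i\<close> sum to 1.\<close>
  have H: "(\<Sum>i = 1..n. H1 (real (c * a i) / 2 ^ K)) = (1 - q) * shannon n P + H1 (1 - q)"
  proof -
    have "(\<Sum>i = 1..n. H1 (real (c * a i) / 2 ^ K)) =
        (\<Sum>i = 1..n. (1 - q) * H1 (P i) + P i * H1 (1 - q))"
      by (intro sum.cong refl) (simp only: Pi H1_mult[OF w0 Ppos])
    then show ?thesis
      by (simp add: sum.distrib shannon_def sum_distrib_left[symmetric] sum_distrib_right[symmetric]
          Psum[simplified])
  qed
  have ci: "c * a i \<le> 2 ^ K" if "i \<in> {1..n}" for i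
  proof -
    have "a i \<le> m" unfolding assms(4) using that by (intro member_le_sum) auto
    then have "c * a i \<le> c * m" by simp
    then show ?thesis using cm by linarith
  qed
  have rK: "r \<le> 2 ^ K" using cm by linarith
  have Hr: "0 \<le> H1 (real r / 2 ^ K)" using w0 by (intro H1_nonneg) (auto simp: q_def W0)
  \<comment> \<open>For the lower bound the nonnegative terms \<open>H1 (1 - q)\<close> and
    \<open>nu K r\<close> are discarded.\<close>
  have "(1 - q) * shannon n P + H1 (1 - q) \<le> (\<Sum>i = 1..n. nu K (c * a i))"
    unfolding H[symmetric] by (intro sum_mono H1_le_nu ci)
  moreover have "0 \<le> H1 (1 - q)" using w0 q0 by (intro H1_nonneg) auto
  moreover have "0 \<le> nu K r" using Hr H1_le_nu[OF rK] by linarith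
  ultimately have "(1 - q) * shannon n P \<le> mean_depth T" unfolding cost2 by linarith
  then have lower: "shannon n P \<le> mean_depth T / (1 - q)"
    using w0 by (simp add: le_divide_eq mult.commute)
  \<comment> \<open>Strictness of the upper bound arises here, from positive weights and
    \<open>n \<ge> 1\<close>; the rejection term may vanish and is bounded only weakly.\<close>
  have "(\<Sum>i = 1..n. nu K (c * a i)) < (\<Sum>i = 1..n. H1 (real (c * a i) / 2 ^ K) + 2 * (real (c * a i) / 2 ^ K))"
    using assms(1,2) c by (intro sum_strict_mono nu_less ci) auto
  also have "\<dots> = (1 - q) * shannon n P + H1 (1 - q) + 2 * (1 - q)"
    unfolding sum.distrib H unfolding Pi sum_distrib_left[symmetric] Psum by simp
  finally have up1: "(\<Sum>i = 1..n. nu K (c * a i)) < \<dots>" .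
  have up2: "nu K r \<le> H1 q + 2 * q"
  proof (cases "r = 0")
    case False
    then show ?thesis using nu_less[OF rK] by (simp add: q_def W0)
  qed (simp add: nu_zero q_def W0 H1_def)
  have up3: "H1 (1 - q) + H1 q + 2 * q \<le> (1 - q) * ((4 + real (K - k)) * (1 / 2 ^ (K - k)))"
  proof (rule rejection_overhead)
    \<comment> \<open>The odds of rejection are \<open>r / (c * m)\<close>; they shrink with
      amplification because \<open>2 ^ (K - k) \<le> c\<close> and \<open>r < m\<close>.\<close>
    have "2 ^ (K - k) * r \<le> c * m" using cD r by (intro mult_mono) auto
    then have "2 ^ (K - k) * real r \<le> real (c * m)"
      by (metis of_nat_le_iff of_nat_mult of_nat_numeral of_nat_power)
    then show "q \<le> (1 - q) * (1 / 2 ^ (K - k))" unfolding w unfolding q_def W0 by (simp add: field_simps)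
  qed (use q0 w0 in auto)
  let ?B = "shannon n P + 2 + (4 + real (K - k)) * (1 / 2 ^ (K - k))"
  have "mean_depth T < (1 - q) * ?B"
    unfolding cost2 using up1 up2 up3 by (simp add: algebra_simps)
  then have upper: "mean_depth T / (1 - q) < ?B"
    using w0 by (simp add: divide_less_eq mult.commute)
  have "2 powr (real k - real K) = 1 / 2 ^ (K - k)"
  proof -
    have "real k - real K = - real (K - k)" using assms(7) by simp
    then show ?thesis by (simp only: powr_minus powr_realpow zero_less_numeral) (simp add: divide_inverse)
  qed
  then have B: "shannon n P + 2 + (4 + real K - real k) * 2 powr (real k - real K) = ?B"
    using assms(7) by (simp add: of_nat_diff)
  have "0 \<le> mean_depth T / (1 - q)" using w0 mean_depth_nonneg by simp
  then show ?thesis unfolding E B using lower upper by (simp add: ennreal_leI ennreal_lessI)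
qed

end
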